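(* Let $k\ge 1$ be an integer and let $n=m^2$ for a positive integer $m$ such that $t=\frac{\sqrt{n}}{k}-1$ is a nonnegative integer. Set $T=\sqrt{n}/k$. Then for every sufficiently large $P>1$, the vector $(y^n_I)_{I\subseteq[n]}$ defined by $y^n_I=\alpha$ for every $I\subseteq[n]$ with $|I|\le t+1$ and $y^n_I=0$ otherwise, where $\alpha>0$ is chosen so that $\sum_{I\subseteq[n]}y^n_I=1$, is feasible for $\mathrm{Las}_t(LP(T))$.
   Context: Scheduling instance: $n=m^2$ unit-cost jobs partitioned into blocks $N_1,\dots,N_m$ of $m$ jobs each; the jobs of block $N_i$ have processing time $P^i$ (with $P>1$), and the demand at the deadline of block $i$ is $D_i=\sum_{j=1}^{i}P^{j-1}$. Variables $x_{ij}$, $i,j\in[m]$, are identified with the elements of $[n]$ via $(i,j)\mapsto (i-1)m+j$. $LP(T)$ consists of the linear constraints $g_0(x)=T-\sum_{i=1}^m\sum_{j=1}^m x_{ij}\ge 0$ and, for each $\ell\in[m]$, $g_\ell(x)=\sum_{i=1}^{\ell}\sum_{j=1}^m P^i x_{ij}-D_\ell\ge 0$. For $I\subseteq[n]$, $x_I\in\{0,1\}^n$ denotes the indicator vector of $I$ ($x_i=1$ iff $i\in I$). For an integer $d\ge 0$, $\mathcal{P}_d(n)$ is the family of subsets of $[n]$ of size at most $d$, and for $I\subseteq[n]$ the zeta vector $Z_I\in\mathbb{R}^{\mathcal{P}_d(n)}$ has entries $[Z_I]_J=1$ if $J\subseteq I$ and $0$ otherwise. The Lasserre relaxation $\mathrm{Las}_t(LP(T))$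 at level $t$ is the set of real vectors $(y^n_I)_{I\subseteq[n]}$ satisfying: (i) $\sum_{I\subseteq[n]}y^n_I=1$; (ii) $\sum_{I\subseteq[n]}y^n_I Z_IZ_I^\top\succeq 0$ with $Z_I\in\mathbb{R}^{\mathcal{P}_{t+1}(n)}$; (iii) for each constraint $g\in\{g_0,g_1,\dots,g_m\}$, $\sum_{I\subseteq[n]}g(x_I)\,y^n_I Z_IZ_I^\top\succeq 0$ with $Z_I\in\mathbb{R}^{\mathcal{P}_{t}(n)}$. Here $\succeq 0$ means positive semidefinite. *)

theory Defs
  imports Complex_Main "HOL-Library.Indicator_Function"
begin

text \<open>A real matrix with rows and columns indexed by a finite set \<open>S\<close> is a function of two
  arguments, of which only the values on \<open>S\<close> matter.\<close>

definition psd_on :: "'a set \<Rightarrow> ('a \<Rightarrow> 'a \<Rightarrow> real) \<Rightarrow> bool" where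
  "psd_on S M \<longleftrightarrow>
     (\<forall>a\<in>S. \<forall>b\<in>S. M a b = M b a) \<and>
     (\<forall>v. (\<Sum>a\<in>S. \<Sum>b\<in>S. v a * M a b * v b) \<ge> 0)"

definition subsets_upto :: "nat \<Rightarrow> nat \<Rightarrow> nat set set" where
  "subsets_upto d n = {J. J \<subseteq> {1..n} \<and> card J \<le> d}"

definition zeta_vec :: "nat set \<Rightarrow> nat set \<Rightarrow> real" where
  "zeta_vec I J = (if J \<subseteq> I then 1 else 0)"

text \<open>The matrix \<open>\<Sum>\<^sub>I w\<^sub>I Z\<^sub>I Z\<^sub>I\<^sup>T\<close>; its size is determined by the index set handed to
  \<^const>\<open>psd_on\<close>.\<close>

definition zeta_matrix :: "nat \<Rightarrow> (nat set \<Rightarrow> real) \<Rightarrow> nat set \<Rightarrow> nat set \<Rightarrow> real" where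
  "zeta_matrix n w A B = (\<Sum>I\<in>Pow {1..n}. w I * (zeta_vec I A * zeta_vec I B))"

text \<open>A point of \<open>\<real>\<^sup>n\<close> is a function \<open>x :: nat \<Rightarrow> real\<close> of which only the values on \<open>{1..n}\<close> matter,
  a constraint \<open>g(x) \<ge> 0\<close> is represented by the function \<open>g\<close>, and a relaxation by the set of its
  constraints. The point \<open>x\<^sub>I\<close> is \<open>indicator I\<close>. A vector \<open>(y\<^sub>I)\<close> is a function on sets of which
  only the values on \<open>Pow {1..n}\<close> matter.\<close>

definition Las :: "nat \<Rightarrow> nat \<Rightarrow> ((nat \<Rightarrow> real) \<Rightarrow> real) set \<Rightarrow> (nat set \<Rightarrow> real) set" where
  "Las n t G =
     {y. (\<Sum>I\<in>Pow {1..n}. y I) = 1 \<and>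
         psd_on (subsets_upto (t + 1) n) (zeta_matrix n y) \<and>
         (\<forall>g\<in>G. psd_on (subsets_upto t n) (zeta_matrix n (\<lambda>I. g (indicator I) * y I)))}"

definition var_index :: "nat \<Rightarrow> nat \<Rightarrow> nat \<Rightarrow> nat" where
  "var_index m i j = (i - 1) * m + j"

definition demand :: "real \<Rightarrow> nat \<Rightarrow> real" where
  "demand P i = (\<Sum>j=1..i. P ^ (j - 1))"

definition g_cost :: "nat \<Rightarrow> real \<Rightarrow> (nat \<Rightarrow> real) \<Rightarrow> real" where
  "g_cost m T x = T - (\<Sum>i=1..m. \<Sum>j=1..m. x (var_index m i j))"

definition g_demand :: "nat \<Rightarrow> real \<Rightarrow> nat \<Rightarrow> (nat \<Rightarrow> real) \<Rightarrow> real" where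
  "g_demand m P l x = (\<Sum>i=1..l. \<Sum>j=1..m. P ^ i * x (var_index m i j)) - demand P l"

definition LP :: "nat \<Rightarrow> real \<Rightarrow> real \<Rightarrow> ((nat \<Rightarrow> real) \<Rightarrow> real) set" where
  "LP m P T = insert (g_cost m T) (g_demand m P ` {1..m})"

definition y_vec :: "nat \<Rightarrow> nat \<Rightarrow> real \<Rightarrow> nat set \<Rightarrow> real" where
  "y_vec n t \<alpha> I = (if I \<subseteq> {1..n} \<and> card I \<le> t + 1 then \<alpha> else 0)"

lemma y_vec_normalised_ex1: "\<exists>!\<alpha>. \<alpha> > 0 \<and> (\<Sum>I\<in>Pow {1..n}. y_vec n t \<alpha> I) = 1"
proof -
  let ?C = "subsets_upto (t + 1) n"
  have C: "?C \<subseteq> Pow {1..n}" by (auto simp: subsets_upto_def)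
  then have fin: "finite ?C" by (rule finite_subset) simp
  have "{} \<in> ?C" by (simp add: subsets_upto_def)
  with fin have pos: "card ?C > 0" by (auto simp: card_gt_0_iff)
  have "(\<Sum>I\<in>Pow {1..n}. y_vec n t \<alpha> I) = (\<Sum>I\<in>?C. \<alpha>)" for \<alpha>
    by (rule sum.mono_neutral_cong_right) (use C in \<open>auto simp: y_vec_def subsets_upto_def\<close>)
  then have *: "(\<Sum>I\<in>Pow {1..n}. y_vec n t \<alpha> I) = real (card ?C) * \<alpha>" for \<alpha>
    by simp
  show ?thesis
    unfolding * by (rule ex1I[of _ "1 / real (card ?C)"]) (use pos in \<open>auto simp: field_simps\<close>)
qed

end

theory Submission imports Defs "HOL-Analysis.Convex" begin

text \<open>The quadratic form of \<open>\<Sum>\<^sub>I w\<^sub>I Z\<^sub>I Z\<^sub>I\<^sup>T\<close> at \<open>v\<close> is \<open>\<Sum>\<^sub>I w\<^sub>I p(I)\<^sup>2\<close>, where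
  \<open>p(I) = \<Sum>\<^sub>J v\<^sub>J [J \<subseteq> I]\<close> is a multilinear polynomial of degree at most \<open>t\<close>. Negative
  weights occur only in the demand constraints, at sets \<open>I\<close> missing the last block \<open>N\<close> of the
  constraint, and they are smaller by a factor of order \<open>P\<close> than the weights at sets meeting \<open>N\<close>.
  It therefore suffices to bound \<open>p(I)\<^sup>2\<close>, for \<open>I\<close> missing \<open>N\<close> and \<open>|I| \<le> t + 1\<close>, by a
  multiple, independent of \<open>P\<close>, of the sum of all \<open>p(K)\<^sup>2\<close> with \<open>K\<close> meeting \<open>N\<close> and
  \<open>|K| \<le> t + 1\<close>. Since \<open>|N| = m \<ge> t + 1\<close>, there are \<open>B \<subseteq> N\<close> of size \<open>t + 1\<close> and an injection of \<open>I\<close>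
  into \<open>B\<close>. For \<open>Z \<subseteq> B\<close> let \<open>I\<^sub>Z\<close> arise from \<open>I\<close> by adding \<open>Z\<close> and deleting the preimages of
  its elements. As a function of \<open>Z\<close>, \<open>p(I\<^sub>Z)\<close> has degree at most \<open>t < |B|\<close>, so its alternating
  sum over all \<open>Z \<subseteq> B\<close> vanishes; the term \<open>Z = {}\<close> is \<open>p(I)\<close>, all the others are of the form
  \<open>p(K)\<close>.\<close>

section \<open>Sign cancellation and quadratic forms of zeta matrices\<close>

lemma finite_subsets_upto [simp]: "finite (subsets_upto d n)"
  by (rule finite_subset[of _ "Pow {1..n}"]) (auto simp: subsets_upto_def)

text \<open>Toggling \<open>b\<close> is an involution of \<open>Pow B\<close> that keeps
  \<open>f\<close> and reverses the sign, so the sum equals its own negative.\<close>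

lemma alternating_sum_Pow_cancel:
  fixes f :: "'a set \<Rightarrow> real"
  assumes B: "finite B" "b \<in> B"
    and inv: "\<And>Z. Z \<subseteq> B \<Longrightarrow> b \<notin> Z \<Longrightarrow> f (insert b Z) = f Z"
  shows "(\<Sum>Z\<in>Pow B. (-1) ^ card Z * f Z) = 0"
proof -
  let ?flip = "\<lambda>Z. if b \<in> Z then Z - {b} else insert b Z"
  have flip: "(-1) ^ card (?flip Z) * f (?flip Z) = - ((-1) ^ card Z * f Z)" if "Z \<subseteq> B" for Z
  proof (cases "b \<in> Z")
    case True
    have "finite Z" using B that finite_subset by blast
    then have "card Z = Suc (card (Z - {b}))" using True by (metis card_Suc_Diff1)
    moreover have "f Z = f (Z - {b})"
      using inv[of "Z - {b}"] that True by (auto simp: insert_absorb)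
    ultimately show ?thesis using True by (simp del: card_Diff_singleton card_Diff_insert)
  next
    case False
    have "finite Z" using B that finite_subset by blast
    then show ?thesis using False inv[OF that False] by simp
  qed
  have "(\<Sum>Z\<in>Pow B. (-1) ^ card Z * f Z) = (\<Sum>Z\<in>Pow B. - ((-1) ^ card Z * f Z))"
    by (rule sum.reindex_bij_witness[of _ ?flip ?flip]) (use B flip in \<open>auto\<close>)
  then show ?thesis by (simp add: sum_negf)
qed

text \<open>\<open>v\<close> lists the coefficients of p in the monomial basis:
  \<open>zeta_vec I J\<close> is the value at the point \<open>indicator I\<close> of the product of
  the variables in \<open>J\<close>.\<close>

definition zeta_poly :: "nat \<Rightarrow> nat \<Rightarrow> (nat set \<Rightarrow> real) \<Rightarrow> nat set \<Rightarrow> real" where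
  "zeta_poly d n v I = (\<Sum>J\<in>subsets_upto d n. v J * zeta_vec I J)"

lemma zeta_matrix_quadratic_form:
  "(\<Sum>A\<in>subsets_upto d n. \<Sum>B\<in>subsets_upto d n. v A * zeta_matrix n w A B * v B) =
   (\<Sum>I\<in>Pow {1..n}. w I * (zeta_poly d n v I)\<^sup>2)"
proof -
  let ?S = "subsets_upto d n"
  have "(\<Sum>A\<in>?S. \<Sum>B\<in>?S. v A * zeta_matrix n w A B * v B) =
    (\<Sum>A\<in>?S. \<Sum>B\<in>?S. \<Sum>I\<in>Pow {1..n}. w I * ((v A * zeta_vec I A) * (v B * zeta_vec I B)))"
    unfolding zeta_matrix_def sum_distrib_left sum_distrib_right
    by (intro sum.cong refl) (simp add: mult_ac)
  also have "\<dots> = (\<Sum>A\<in>?S. \<Sum>I\<in>Pow {1..n}. \<Sum>B\<in>?S. w I * ((v A * zeta_vec I A) * (v B * zeta_vec I B)))"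
    by (intro sum.cong refl sum.swap)
  also have "\<dots> = (\<Sum>I\<in>Pow {1..n}. \<Sum>A\<in>?S. \<Sum>B\<in>?S. w I * ((v A * zeta_vec I A) * (v B * zeta_vec I B)))"
    by (rule sum.swap)
  also have "\<dots> = (\<Sum>I\<in>Pow {1..n}. w I * (zeta_poly d n v I)\<^sup>2)"
    unfolding zeta_poly_def power2_eq_square sum_product unfolding sum_distrib_left ..
  finally show ?thesis .
qed

lemma psd_on_zeta_matrix_iff:
  "psd_on (subsets_upto d n) (zeta_matrix n w) \<longleftrightarrow>
   (\<forall>v. (\<Sum>I\<in>Pow {1..n}. w I * (zeta_poly d n v I)\<^sup>2) \<ge> 0)"
  unfolding psd_on_def zeta_matrix_quadratic_form by (auto simp: zeta_matrix_def mult_ac)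

lemma sum_y_vec:
  "(\<Sum>I\<in>Pow {1..n}. c I * y_vec n t \<alpha> I * q I) = \<alpha> * (\<Sum>I\<in>subsets_upto (t + 1) n. c I * q I)"
  unfolding sum_distrib_left
  by (rule sum.mono_neutral_cong_right) (auto simp: y_vec_def subsets_upto_def)

text \<open>The form is a sum of squares with nonnegative weights. This settles the moment matrix
  (\<open>c\<close> constantly 1, \<open>d = t + 1\<close>) and the cost constraint.\<close>

lemma psd_on_zeta_matrix_y_vec:
  assumes "\<alpha> \<ge> 0" "\<And>I. I \<in> subsets_upto (t + 1) n \<Longrightarrow> c I \<ge> 0"
  shows "psd_on (subsets_upto d n) (zeta_matrix n (\<lambda>I. c I * y_vec n t \<alpha> I))"
  unfolding psd_on_zeta_matrix_iff sum_y_vec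
  by (intro allI mult_nonneg_nonneg sum_nonneg) (use assms in auto)

section \<open>Trading sets that miss a block for sets that meet it\<close>

lemma zeta_poly_square_le:
  assumes N: "N \<subseteq> {1..n}" "t + 1 \<le> card N"
    and I: "I \<in> subsets_upto (t + 1) n" "I \<inter> N = {}"
  shows "(zeta_poly t n v I)\<^sup>2 \<le>
    2 ^ (t + 1) * (\<Sum>K\<in>{K \<in> subsets_upto (t + 1) n. K \<inter> N \<noteq> {}}. (zeta_poly t n v K)\<^sup>2)"
proof -
  let ?p = "zeta_poly t n v" and ?M = "{K \<in> subsets_upto (t + 1) n. K \<inter> N \<noteq> {}}"
  obtain B where B: "B \<subseteq> N" "card B = t + 1" "finite B"
    using obtain_subset_with_card_n[OF N(2)] by blast
  have finI: "finite I" using I(1) finite_subset by (fastforce simp: subsets_upto_def)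
  have "card I \<le> card B" using I(1) B by (simp add: subsets_upto_def)
  then obtain f where f: "f ` I \<subseteq> B" "inj_on f I"
    using card_le_inj[OF finI B(3)] by blast
  define K where "K = (\<lambda>Z. Z \<union> {a \<in> I. f a \<notin> Z})"
  have KM: "K Z \<in> ?M" if "Z \<in> Pow B - {{}}" for Z
  proof -
    have ZB: "Z \<subseteq> B" and finZ: "finite Z" using that B(3) finite_subset by auto
    \<comment> \<open>The surviving elements of \<open>I\<close> inject into \<open>B - Z\<close>,
      so adding \<open>Z\<close> never pushes the size above \<open>card B = t + 1\<close>.\<close>
    have "card {a \<in> I. f a \<notin> Z} \<le> card (B - Z)"
      by (rule card_inj_on_le[of f]) (use f B in \<open>auto intro: inj_on_subset\<close>)
    also have "\<dots> = card B - card Z" using finZ ZB by (simp add: card_Diff_subset)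
    finally have "card (K Z) \<le> t + 1"
      using card_Un_le[of Z "{a \<in> I. f a \<notin> Z}"] card_mono[OF B(3) ZB] B(2)
      unfolding K_def by linarith
    moreover have "K Z \<subseteq> {1..n}" using ZB B N I unfolding K_def subsets_upto_def by blast
    moreover have "K Z \<inter> N \<noteq> {}" using that B unfolding K_def by blast
    ultimately show ?thesis by (simp add: subsets_upto_def)
  qed
  have inj: "inj_on K (Pow B - {{}})"
  proof (rule inj_on_inverseI[where g = "\<lambda>S. S \<inter> N"])
    fix Z assume "Z \<in> Pow B - {{}}"
    then show "K Z \<inter> N = Z" using I(2) B(1) unfolding K_def by blast
  qed
  have vanish: "(\<Sum>Z\<in>Pow B. (-1) ^ card Z * zeta_vec (K Z) J) = 0" if J: "J \<in> subsets_upto t n" for J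
  proof -
    have finJ: "finite J" using J finite_subset by (fastforce simp: subsets_upto_def)
    \<comment> \<open>Whether \<open>x\<close> lies in \<open>K Z\<close> depends on
      \<open>Z\<close> only through whether \<open>?h x\<close> is in \<open>Z\<close>; here
      \<open>I\<close> being disjoint from \<open>N\<close> matters. Since \<open>J\<close> has at
      most \<open>t\<close> elements, some \<open>b\<close> in \<open>B\<close> is left free to
      toggle.\<close>
    let ?h = "\<lambda>x. if x \<in> I then f x else x"
    have "card (?h ` J) < card B"
      using card_image_le[OF finJ, of ?h] J B(2) by (simp add: subsets_upto_def)
    then have "\<not> B \<subseteq> ?h ` J" using card_mono[of "?h ` J" B] finJ by auto
    then obtain b where b: "b \<in> B" "b \<notin> ?h ` J" by blast
    have bI: "b \<notin> I" using b B I by blast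
    have bJ: "b \<notin> J" using b(2) bI by (metis (mono_tags, lifting) image_eqI)
    have fJ: "f a \<noteq> b" if "a \<in> J" "a \<in> I" for a
      using b(2) that by (metis (mono_tags, lifting) image_eqI)
    show ?thesis
    proof (rule alternating_sum_Pow_cancel[OF B(3) b(1)])
      fix Z assume "Z \<subseteq> B" "b \<notin> Z"
      have "J \<subseteq> K (insert b Z) \<longleftrightarrow> J \<subseteq> K Z" using bJ fJ unfolding K_def by blast
      then show "zeta_vec (K (insert b Z)) J = zeta_vec (K Z) J" by (simp add: zeta_vec_def)
    qed
  qed
  have "(\<Sum>Z\<in>Pow B. (-1) ^ card Z * ?p (K Z)) =
      (\<Sum>J\<in>subsets_upto t n. v J * (\<Sum>Z\<in>Pow B. (-1) ^ card Z * zeta_vec (K Z) J))"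
    unfolding zeta_poly_def sum_distrib_left by (subst sum.swap) (simp add: mult_ac)
  also have "\<dots> = 0" using vanish by simp
  finally have "?p I = - (\<Sum>Z\<in>Pow B - {{}}. (-1) ^ card Z * ?p (K Z))"
    using sum.remove[of "Pow B" "{}" "\<lambda>Z. (-1) ^ card Z * ?p (K Z)"] B(3) by (simp add: K_def)
  then have "(?p I)\<^sup>2 = (\<Sum>Z\<in>Pow B - {{}}. (-1) ^ card Z * ?p (K Z))\<^sup>2" by simp
  \<comment> \<open>Cauchy-Schwarz; the number of summands is the source of the factor
    \<open>2 ^ (t + 1)\<close>.\<close>
  also have "\<dots> \<le> real (card (Pow B - {{}})) * (\<Sum>Z\<in>Pow B - {{}}. ((-1) ^ card Z * ?p (K Z))\<^sup>2)"
    using sum_squared_le_sum_of_squares[of "\<lambda>Z. (-1) ^ card Z * ?p (K Z)" "Pow B - {{}}"]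
    by (simp add: mult.commute)
  also have "\<dots> = real (card (Pow B - {{}})) * (\<Sum>Z\<in>Pow B - {{}}. (?p (K Z))\<^sup>2)"
    by (simp add: power_mult_distrib flip: power_mult)
  also have "\<dots> = real (card (Pow B - {{}})) * (\<Sum>S\<in>K ` (Pow B - {{}}). (?p S)\<^sup>2)"
    by (simp add: sum.reindex[OF inj])
  also have "\<dots> \<le> 2 ^ (t + 1) * (\<Sum>S\<in>?M. (?p S)\<^sup>2)"
  proof (rule mult_mono)
    have "card (Pow B - {{}}) \<le> card (Pow B)" by (rule card_mono) (use B in auto)
    then have "card (Pow B - {{}}) \<le> 2 ^ (t + 1)" using B by (simp add: card_Pow)
    then show "real (card (Pow B - {{}})) \<le> 2 ^ (t + 1)"
      by (metis of_nat_le_iff of_nat_numeral of_nat_power)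
    show "(\<Sum>S\<in>K ` (Pow B - {{}}). (?p S)\<^sup>2) \<le> (\<Sum>S\<in>?M. (?p S)\<^sup>2)"
      by (rule sum_mono2) (use KM in auto)
  qed (auto intro: sum_nonneg)
  finally show ?thesis .
qed

text \<open>In the factor required of \<open>c\<close> on sets meeting \<open>N\<close>,
  \<open>2 ^ (t + 1)\<close> pays for one set missing \<open>N\<close> and \<open>2 ^ n\<close>
  bounds the number of such sets.\<close>

lemma psd_on_zeta_matrix_y_vec_block:
  assumes N: "N \<subseteq> {1..n}" "t + 1 \<le> card N" and "\<alpha> \<ge> 0" "b \<ge> 0"
    and hit: "\<And>I. I \<subseteq> {1..n} \<Longrightarrow> I \<inter> N \<noteq> {} \<Longrightarrow> c I \<ge> 2 ^ n * 2 ^ (t + 1) * b"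
    and miss: "\<And>I. I \<subseteq> {1..n} \<Longrightarrow> I \<inter> N = {} \<Longrightarrow> c I \<ge> - b"
  shows "psd_on (subsets_upto t n) (zeta_matrix n (\<lambda>I. c I * y_vec n t \<alpha> I))"
  unfolding psd_on_zeta_matrix_iff sum_y_vec
proof (intro allI mult_nonneg_nonneg)
  fix v
  let ?p = "zeta_poly t n v" and ?S = "subsets_upto (t + 1) n"
  let ?M = "{K \<in> ?S. K \<inter> N \<noteq> {}}" and ?L = "{K \<in> ?S. K \<inter> N = {}}"
  define Q where "Q = (\<Sum>K\<in>?M. (?p K)\<^sup>2)"
  have Q: "Q \<ge> 0" unfolding Q_def by (rule sum_nonneg) simp
  have "card ?L \<le> card (Pow {1..n})" by (rule card_mono) (auto simp: subsets_upto_def)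
  then have "card ?L \<le> 2 ^ n" by (simp add: card_Pow)
  then have L: "real (card ?L) \<le> 2 ^ n" by (metis of_nat_le_iff of_nat_numeral of_nat_power)
  have "(\<Sum>K\<in>?L. (?p K)\<^sup>2) \<le> (\<Sum>K\<in>?L. 2 ^ (t + 1) * Q)"
    unfolding Q_def by (rule sum_mono) (use zeta_poly_square_le[OF N] in auto)
  also have "\<dots> = real (card ?L) * (2 ^ (t + 1) * Q)" by simp
  also have "\<dots> \<le> 2 ^ n * (2 ^ (t + 1) * Q)"
    by (rule mult_right_mono[OF L]) (use Q in simp)
  finally have *: "b * (\<Sum>K\<in>?L. (?p K)\<^sup>2) \<le> b * (2 ^ n * (2 ^ (t + 1) * Q))"
    using \<open>b \<ge> 0\<close> by (rule mult_left_mono)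
  have "(\<Sum>K\<in>?M. 2 ^ n * 2 ^ (t + 1) * b * (?p K)\<^sup>2) \<le> (\<Sum>K\<in>?M. c K * (?p K)\<^sup>2)"
    by (intro sum_mono mult_right_mono hit) (auto simp: subsets_upto_def)
  then have 1: "2 ^ n * 2 ^ (t + 1) * b * Q \<le> (\<Sum>K\<in>?M. c K * (?p K)\<^sup>2)"
    unfolding Q_def sum_distrib_left .
  have "(\<Sum>K\<in>?L. - b * (?p K)\<^sup>2) \<le> (\<Sum>K\<in>?L. c K * (?p K)\<^sup>2)"
    by (intro sum_mono mult_right_mono miss) (auto simp: subsets_upto_def)
  then have 2: "- b * (\<Sum>K\<in>?L. (?p K)\<^sup>2) \<le> (\<Sum>K\<in>?L. c K * (?p K)\<^sup>2)"
    unfolding sum_distrib_left .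
  have "(\<Sum>K\<in>?S. c K * (?p K)\<^sup>2) = (\<Sum>K\<in>?M. c K * (?p K)\<^sup>2) + (\<Sum>K\<in>?L. c K * (?p K)\<^sup>2)"
    by (subst sum.union_disjoint[symmetric]) (auto intro!: sum.cong)
  then show "(\<Sum>K\<in>?S. c K * (?p K)\<^sup>2) \<ge> 0" using * 1 2 by (simp add: mult_ac)
qed (rule \<open>\<alpha> \<ge> 0\<close>)

section \<open>Constraint values at indicator vectors\<close>

lemma bij_betw_var_index:
  "bij_betw (\<lambda>(i, j). var_index m i j) ({1..m} \<times> {1..m}) {1..m\<^sup>2}"
\<comment> \<open>Row-major numbering is inverted by division with remainder by \<open>m\<close>;
  the shifts by one occur because all indices start at 1.\<close>
proof (rule bij_betw_byWitness[where f' = "\<lambda>x. ((x - 1) div m + 1, (x - 1) mod m + 1)"])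
  have lt: "(i - 1) * m + j \<le> m\<^sup>2" if "i \<in> {1..m}" "j \<in> {1..m}" for i j
  proof -
    have "(i - 1) * m + j \<le> (i - 1) * m + m" using that by simp
    also have "\<dots> = i * m" using that by (cases i) auto
    also have "\<dots> \<le> m\<^sup>2" using that by (simp add: power2_eq_square)
    finally show ?thesis .
  qed
  show "(\<lambda>(i, j). var_index m i j) ` ({1..m} \<times> {1..m}) \<subseteq> {1..m\<^sup>2}"
    using lt by (auto simp: var_index_def)
  show "\<forall>a\<in>{1..m} \<times> {1..m}. (\<lambda>x. ((x - 1) div m + 1, (x - 1) mod m + 1)) (case a of (i, j) \<Rightarrow> var_index m i j) = a"
  proof safe
    fix i j assume ij: "i \<in> {1..m}" "j \<in> {1..m}"
    obtain i' j' where "i = Suc i'" "j = Suc j'" "j' < m"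
      using ij by (cases i; cases j) auto
    then show "(var_index m i j - 1) div m + 1 = i" "(var_index m i j - 1) mod m + 1 = j"
      by (auto simp: var_index_def)
  qed
  show "\<forall>a\<in>{1..m\<^sup>2}. (case ((a - 1) div m + 1, (a - 1) mod m + 1) of (i, j) \<Rightarrow> var_index m i j) = a"
    by (auto simp: var_index_def)
  show "(\<lambda>x. ((x - 1) div m + 1, (x - 1) mod m + 1)) ` {1..m\<^sup>2} \<subseteq> {1..m} \<times> {1..m}"
  proof safe
    fix x assume x: "x \<in> {1..m\<^sup>2}"
    then have m: "m > 0" by (cases m) auto
    have "x - 1 < m * m" using x by (auto simp: power2_eq_square)
    then have "(x - 1) div m < m" by (rule less_mult_imp_div_less)
    then show "(x - 1) div m + 1 \<in> {1..m}" by simp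
    show "(x - 1) mod m + 1 \<in> {1..m}" using m by (simp add: Suc_leI)
  qed
qed

lemma g_cost_indicator:
  assumes "I \<subseteq> {1..m\<^sup>2}"
  shows "g_cost m T (indicator I) = T - real (card I)"
proof -
  have "(\<Sum>i=1..m. \<Sum>j=1..m. indicator I (var_index m i j) :: real) =
      (\<Sum>z\<in>{1..m} \<times> {1..m}. indicator I (case z of (i, j) \<Rightarrow> var_index m i j))"
    by (simp add: sum.cartesian_product case_prod_unfold)
  also have "\<dots> = (\<Sum>x\<in>{1..m\<^sup>2}. indicator I x)"
    by (rule sum.reindex_bij_betw[OF bij_betw_var_index])
  also have "\<dots> = (\<Sum>x\<in>I. 1)"
    by (rule sum.mono_neutral_cong_right) (use assms in auto)
  finally show ?thesis by (simp add: g_cost_def)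
qed

lemma demand_le:
  assumes "P \<ge> 1"
  shows "demand P l \<le> real l * P ^ (l - 1)"
proof -
  have "demand P l \<le> (\<Sum>j=1..l. P ^ (l - 1))"
    unfolding demand_def by (intro sum_mono power_increasing) (use assms in auto)
  then show ?thesis by simp
qed

lemma g_demand_indicator_ge:
  assumes "P \<ge> 1"
  shows "g_demand m P l (indicator I) \<ge> - (real l * P ^ (l - 1))"
proof -
  have "(\<Sum>i=1..l. \<Sum>j=1..m. P ^ i * indicator I (var_index m i j)) \<ge> 0"
    using assms by (intro sum_nonneg) auto
  then show ?thesis using demand_le[OF assms, of l] by (simp add: g_demand_def)
qed

text \<open>A single job of block \<open>l\<close> already contributes \<open>P ^ l\<close>, whereas
  the whole demand is at most \<open>l\<close> times \<open>P ^ (l - 1)\<close>; this is the gap of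
  order \<open>P\<close>.\<close>

lemma g_demand_indicator_ge_hit:
  assumes P: "P \<ge> 1" and l: "l \<ge> 1" and j: "j \<in> {1..m}" "var_index m l j \<in> I"
  shows "g_demand m P l (indicator I) \<ge> (P - real l) * P ^ (l - 1)"
proof -
  have "P ^ l \<le> (\<Sum>j=1..m. P ^ l * indicator I (var_index m l j))"
    using member_le_sum[of j "{1..m}" "\<lambda>j. P ^ l * indicator I (var_index m l j)"] j P by simp
  also have "\<dots> \<le> (\<Sum>i=1..l. \<Sum>j=1..m. P ^ i * indicator I (var_index m i j))"
    using member_le_sum[of l "{1..l}" "\<lambda>i. \<Sum>j=1..m. P ^ i * indicator I (var_index m i j)"] l P
    by (simp add: sum_nonneg)
  finally have "g_demand m P l (indicator I) \<ge> P ^ l - real l * P ^ (l - 1)"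
    using demand_le[OF P, of l] by (simp add: g_demand_def)
  moreover have "P ^ l = P * P ^ (l - 1)" using l by (cases l) auto
  ultimately show ?thesis by (simp add: algebra_simps)
qed

section \<open>Feasibility beyond an explicit threshold on \<open>P\<close>\<close>

theorem theorem2:
  fixes k m n t :: nat and T \<alpha> :: real
  assumes "k \<ge> 1"
    and "m \<ge> 1"
    and "n = m ^ 2"
    and "real t = sqrt (real n) / real k - 1"
    and "T = sqrt (real n) / real k"
    and "\<alpha> > 0"
    and "(\<Sum>I\<in>Pow {1..n}. y_vec n t \<alpha> I) = 1"
  shows "\<exists>P\<^sub>0>1. \<forall>P::real. P \<ge> P\<^sub>0 \<longrightarrow> y_vec n t \<alpha> \<in> Las n t (LP m P T)"
proof -
  define C :: real where "C = 2 ^ n * 2 ^ (t + 1)"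
  have C: "C \<ge> 0" by (simp add: C_def)
  \<comment> \<open>The budget is exactly the largest size of a set in the support of
    \<open>y_vec\<close>, so the cost constraint is nonnegative there.\<close>
  have T: "T = real t + 1" using assms by simp
  have "T = real m / real k" using assms by simp
  also have "\<dots> \<le> real m" using \<open>k \<ge> 1\<close> divide_left_mono[of 1 "real k" "real m"] by simp
  finally have tm: "t + 1 \<le> m" using T by linarith
  \<comment> \<open>As \<open>l\<close> is at most \<open>m\<close>, the part
    \<open>real m + C * real m\<close> yields \<open>P - real l \<ge> C * real m\<close>, the ratio
    needed with \<open>b = real m * P ^ (l - 1)\<close>; the 2 puts the threshold above 1.\<close>
  have "y_vec n t \<alpha> \<in> Las n t (LP m P T)" if P: "P \<ge> 2 + real m + C * real m" for P
  proof -
    have P1: "P \<ge> 1" using P C by (smt (verit) mult_nonneg_nonneg of_nat_0_le_iff)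
    have cost: "psd_on (subsets_upto t n) (zeta_matrix n (\<lambda>I. g_cost m T (indicator I) * y_vec n t \<alpha> I))"
      by (rule psd_on_zeta_matrix_y_vec)
        (use assms T in \<open>auto simp: subsets_upto_def g_cost_indicator\<close>)
    have dem: "psd_on (subsets_upto t n)
        (zeta_matrix n (\<lambda>I. g_demand m P l (indicator I) * y_vec n t \<alpha> I))" if l: "l \<in> {1..m}" for l
    proof (rule psd_on_zeta_matrix_y_vec_block[where N = "var_index m l ` {1..m}" and b = "real m * P ^ (l - 1)"])
      show "var_index m l ` {1..m} \<subseteq> {1..n}"
        using bij_betw_imp_surj_on[OF bij_betw_var_index[of m]] l assms(3) by force
      have "inj_on (var_index m l) {1..m}" by (auto simp: inj_on_def var_index_def)
      then show "t + 1 \<le> card (var_index m l ` {1..m})" using tm by (simp add: card_image)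
      fix I
      have "- (real m * P ^ (l - 1)) \<le> - (real l * P ^ (l - 1))"
        using l P1 by (simp add: mult_right_mono)
      then show "- (real m * P ^ (l - 1)) \<le> g_demand m P l (indicator I)"
        using g_demand_indicator_ge[OF P1, of l m I] by linarith
      assume "I \<inter> var_index m l ` {1..m} \<noteq> {}"
      then obtain j where j: "j \<in> {1..m}" "var_index m l j \<in> I" by blast
      have "C * real m \<le> P - real l" using P l by auto
      then have "C * real m * P ^ (l - 1) \<le> (P - real l) * P ^ (l - 1)"
        using P1 by (intro mult_right_mono) auto
      also have "\<dots> \<le> g_demand m P l (indicator I)"
        using g_demand_indicator_ge_hit[OF P1 _ j] l by simp
      finally show "2 ^ n * 2 ^ (t + 1) * (real m * P ^ (l - 1)) \<le> g_demand m P l (indicator I)"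
        by (simp add: C_def mult_ac)
    qed (use assms P1 in auto)
    have "psd_on (subsets_upto (t + 1) n) (zeta_matrix n (y_vec n t \<alpha>))"
      using psd_on_zeta_matrix_y_vec[of \<alpha> t n "\<lambda>_. 1" "t + 1"] assms(6) by simp
    then show ?thesis using assms(7) cost dem by (auto simp: Las_def LP_def)
  qed
  moreover have "2 + real m + C * real m > 1" using C by (smt (verit) mult_nonneg_nonneg of_nat_0_le_iff)
  ultimately show ?thesis by blast
qed

end
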